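(* Let $f:\mathbb{R}^n\to\mathbb{R}$ and $g=(g_1,\dots,g_q):\mathbb{R}^n\to\mathbb{R}^q$ be locally Lipschitz continuous, and consider the problem (P): $\min_x f(x)$ subject to $g(x)\le 0$. If $\bar{x}$ is feasible for (P) and the Subset Mangasarian-Fromovitz Condition (subMFC) holds at $\bar{x}$, then $\bar{x}$ is a KKT point of (P).
   Context: Inequalities between vectors are componentwise; sums and multiples of sets are in the Minkowski sense, and an empty sum is $\{0\}$. For a locally Lipschitz $\phi:\mathbb{R}^n\to\mathbb{R}$, $\partial\phi(\bar x)$ is the Clarke subdifferential: $\partial\phi(\bar x)=\{s\in\mathbb{R}^n : s^\top d\le \phi^\circ(\bar x;d)\ \forall d\in\mathbb{R}^n\}$ with $\phi^\circ(\bar x;d)=\limsup_{x\to\bar x,\,h\downarrow 0}\frac{\phi(x+hd)-\phi(x)}{h}$. KKT point: $\bar x$ is a KKT point of (P) if there is $u\in\mathbb{R}^q$ with $0\in\partial f(\bar x)+\sum_{j=1}^q u_j\partial g_j(\bar x)$, $u\ge 0$, $g(\bar x)\le 0$, $u^\top g(\bar x)=0$. AKKT sequence for $\bar x$: a sequence $\{(x^k,u^k,\delta^k,\epsilon^k)\}_{k=1}^\infty\subset\mathbb{R}^n\times\mathbb{R}^q\times\mathbb{R}^q\times\mathbb{R}^n$ such that for all $k\in\mathbb{N}$: $\epsilon^k\in\partial f(x^k)+\sum_{j=1}^q u^k_j\partial g_j(x^k)$, $u^k\ge 0$, $g(x^k)\le\delta^k$, $(u^k)^\top(g(x^k)-\delta^k)=0$;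 and $(x^k,\delta^k,\epsilon^k)\to(\bar x,0,0)$ as $k\to\infty$. Active sets: $I(\bar x)=\{j\in\{1,\dots,q\}: g_j(\bar x)=0\}$; for $g(x)\le\delta$, $I(x,\delta)=\{j\in\{1,\dots,q\}: g_j(x)=\delta_j\}$. subMFC holds at a feasible point $\bar x$ if there exists $I\subseteq I(\bar x)$ such that: (i) if $I\neq\emptyset$, then for all $v=(v_j)_{j\in I}\ge 0$, $v\ne 0$, one has $0\notin\sum_{j\in I}v_j\partial g_j(\bar x)$; (ii) there exists an AKKT sequence for $\bar x$ with $I=I(x^k,\delta^k)$ for all $k\in\mathbb{N}$. *)

theory Defs
  imports "HOL-Analysis.Analysis"
begin

text \<open>
  The library notion \<^const>\<open>local_lipschitz\<close> is for families of functions indexed by a metric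
  space. A single function is a constant family; the next lemma shows that this is the usual notion.
\<close>

definition locally_lipschitz :: "('a::metric_space \<Rightarrow> 'b::metric_space) \<Rightarrow> bool" where
  "locally_lipschitz \<phi> \<longleftrightarrow> local_lipschitz (UNIV :: real set) UNIV (\<lambda>_. \<phi>)"

lemma locally_lipschitz_iff:
  "locally_lipschitz \<phi> \<longleftrightarrow> (\<forall>x. \<exists>r>0. \<exists>L. L-lipschitz_on (cball x r) \<phi>)"
proof -
  have "(\<forall>s\<in>cball (t::real) r. P) \<longleftrightarrow> P" if "r > 0" for t r P
    using that by (metis centre_in_cball less_imp_le)
  then show ?thesis
    unfolding locally_lipschitz_def local_lipschitz_def
    by (simp cong: conj_cong)
qed

text \<open>
  The base point \<open>y\<close> may equal \<open>x\<close> (hence \<^const>\<open>nhds\<close> and not \<^const>\<open>at\<close>), while \<open>h > 0\<close>.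
\<close>

definition clarke_dderiv :: "('a::euclidean_space \<Rightarrow> real) \<Rightarrow> 'a \<Rightarrow> 'a \<Rightarrow> ereal" where
  "clarke_dderiv \<phi> x d =
     Limsup (nhds x \<times>\<^sub>F at_right (0::real)) (\<lambda>(y, h). ereal ((\<phi> (y + h *\<^sub>R d) - \<phi> y) / h))"

definition clarke_subdiff :: "('a::euclidean_space \<Rightarrow> real) \<Rightarrow> 'a \<Rightarrow> 'a set" where
  "clarke_subdiff \<phi> x = {s. \<forall>d. ereal (s \<bullet> d) \<le> clarke_dderiv \<phi> x d}"

text \<open>
  Below, \<open>+\<close> and \<open>\<Sum>\<close> on sets are the Minkowski operations of \<^theory>\<open>HOL-Library.Set_Algebras\<close>
  (the empty sum is \<open>{0}\<close>), a multiple of a set is an image under \<^const>\<open>scaleR\<close>, and \<open>\<le>\<close> on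
  \<^typ>\<open>real ^ 'q\<close> is the componentwise order.
\<close>

definition KKT_point ::
  "(real ^ 'n \<Rightarrow> real) \<Rightarrow> (real ^ 'n \<Rightarrow> real ^ 'q) \<Rightarrow> real ^ 'n \<Rightarrow> bool" where
  "KKT_point f g xbar \<longleftrightarrow>
     (\<exists>u :: real ^ 'q.
        0 \<in> clarke_subdiff f xbar
            + (\<Sum>j\<in>UNIV. (*\<^sub>R) (u $ j) ` clarke_subdiff (\<lambda>x. g x $ j) xbar) \<and>
        0 \<le> u \<and> g xbar \<le> 0 \<and> u \<bullet> g xbar = 0)"

definition AKKT_sequence ::
  "(real ^ 'n \<Rightarrow> real) \<Rightarrow> (real ^ 'n \<Rightarrow> real ^ 'q) \<Rightarrow> real ^ 'n \<Rightarrow>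
   (nat \<Rightarrow> real ^ 'n) \<Rightarrow> (nat \<Rightarrow> real ^ 'q) \<Rightarrow> (nat \<Rightarrow> real ^ 'q) \<Rightarrow> (nat \<Rightarrow> real ^ 'n) \<Rightarrow> bool" where
  "AKKT_sequence f g xbar x u \<delta> \<epsilon> \<longleftrightarrow>
     (\<forall>k. \<epsilon> k \<in> clarke_subdiff f (x k)
                + (\<Sum>j\<in>UNIV. (*\<^sub>R) (u k $ j) ` clarke_subdiff (\<lambda>y. g y $ j) (x k)) \<and>
          0 \<le> u k \<and> g (x k) \<le> \<delta> k \<and> u k \<bullet> (g (x k) - \<delta> k) = 0) \<and>
     ((\<lambda>k. (x k, \<delta> k, \<epsilon> k)) \<longlonglongrightarrow> (xbar, 0, 0))"

definition active_set :: "(real ^ 'n \<Rightarrow> real ^ 'q) \<Rightarrow> real ^ 'n \<Rightarrow> 'q set" where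
  "active_set g xbar = {j. g xbar $ j = 0}"

definition active_set_pert :: "(real ^ 'n \<Rightarrow> real ^ 'q) \<Rightarrow> real ^ 'n \<Rightarrow> real ^ 'q \<Rightarrow> 'q set" where
  "active_set_pert g x \<delta> = {j. g x $ j = \<delta> $ j}"

text \<open>
  The vector \<open>(v\<^sub>j)\<close> with \<open>j \<in> I\<close> is a total function \<open>v\<close> of which only the values on \<open>I\<close> are used.
\<close>

definition subMFC ::
  "(real ^ 'n \<Rightarrow> real) \<Rightarrow> (real ^ 'n \<Rightarrow> real ^ 'q) \<Rightarrow> real ^ 'n \<Rightarrow> bool" where
  "subMFC f g xbar \<longleftrightarrow>
     (\<exists>I \<subseteq> active_set g xbar.
        (I \<noteq> {} \<longrightarrow>
           (\<forall>v :: 'q \<Rightarrow> real. (\<forall>j\<in>I. 0 \<le> v j) \<and> (\<exists>j\<in>I. v j \<noteq> 0) \<longrightarrow>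
              0 \<notin> (\<Sum>j\<in>I. (*\<^sub>R) (v j) ` clarke_subdiff (\<lambda>x. g x $ j) xbar))) \<and>
        (\<exists>x u \<delta> \<epsilon>. AKKT_sequence f g xbar x u \<delta> \<epsilon> \<and>
           (\<forall>k. I = active_set_pert g (x k) (\<delta> k))))"

end

theory Submission
  imports Defs
begin

text \<open>
  Write \<open>\<epsilon>\<^sup>k = a\<^sup>k + \<Sum>\<^sub>j u\<^sup>k\<^sub>j b\<^sup>k\<^sub>j\<close> with subgradients \<open>a\<^sup>k\<close>, \<open>b\<^sup>k\<^sub>j\<close>, which are bounded by local Lipschitz
  constants. Dividing by \<open>1 + \<Sum>\<^sub>j u\<^sup>k\<^sub>j\<close> makes all coefficients bounded, so that along a subsequence
  they converge, and since the Clarke subdifferential has closed graph this gives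
  \<open>0 = \<lambda> a + \<Sum>\<^sub>j w\<^sub>j b\<^sub>j\<close> with subgradients at \<open>xbar\<close>, \<open>\<lambda> + \<Sum>\<^sub>j w\<^sub>j = 1\<close> and \<open>w\<^sub>j = 0\<close> off \<open>I\<close>.
  Condition (i) of subMFC excludes \<open>\<lambda> = 0\<close>, and \<open>u = w / \<lambda>\<close> is a KKT multiplier.
\<close>

section \<open>Minkowski combinations of sets\<close>

lemma mem_sum_scaleR_image_iff:
  fixes S :: "'i \<Rightarrow> 'a::real_vector set"
  assumes "finite I"
  shows "y \<in> (\<Sum>j\<in>I. (*\<^sub>R) (c j) ` S j) \<longleftrightarrow>
    (\<exists>b. (\<forall>j\<in>I. b j \<in> S j) \<and> y = (\<Sum>j\<in>I. c j *\<^sub>R b j))"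
proof
  assume "y \<in> (\<Sum>j\<in>I. (*\<^sub>R) (c j) ` S j)"
  then obtain a where a: "y = sum a I" "\<forall>j\<in>I. a j \<in> (*\<^sub>R) (c j) ` S j"
    unfolding set_sum_alt[OF assms] by blast
  then have "\<forall>j\<in>I. \<exists>b. b \<in> S j \<and> a j = c j *\<^sub>R b"
    by blast
  then obtain b where "\<forall>j\<in>I. b j \<in> S j \<and> a j = c j *\<^sub>R b j"
    by metis
  then show "\<exists>b. (\<forall>j\<in>I. b j \<in> S j) \<and> y = (\<Sum>j\<in>I. c j *\<^sub>R b j)"
    using a(1) by (intro exI[of _ b]) simp
next
  assume "\<exists>b. (\<forall>j\<in>I. b j \<in> S j) \<and> y = (\<Sum>j\<in>I. c j *\<^sub>R b j)"
  then show "y \<in> (\<Sum>j\<in>I. (*\<^sub>R) (c j) ` S j)"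
    unfolding set_sum_alt[OF assms] by blast
qed

section \<open>Limits and bounds for Clarke subgradients\<close>

lemma clarke_dderiv_le_of_eventually:
  assumes "\<forall>\<^sub>F (y, h) in nhds x \<times>\<^sub>F at_right 0. (\<phi> (y + h *\<^sub>R d) - \<phi> y) / h \<le> c"
  shows "clarke_dderiv \<phi> x d \<le> ereal c"
  unfolding clarke_dderiv_def
  by (rule Limsup_bounded, rule eventually_mono[OF assms]) auto

text \<open>Upper semicontinuity in the base point: a neighbourhood of \<open>x\<close> on which the
  quotients stay below \<open>c\<close> is also a neighbourhood of every \<open>y\<close> close to
  \<open>x\<close>, so the same \<open>P\<close> and \<open>Q\<close> bound the limsup at
  \<open>y\<close>. The strict inequality weakens to a non-strict one there.\<close>

lemma eventually_clarke_dderiv_le: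
  assumes "clarke_dderiv \<phi> x d < ereal c"
  shows "\<forall>\<^sub>F y in nhds x. clarke_dderiv \<phi> y d \<le> ereal c"
proof -
  let ?q = "\<lambda>y h. (\<phi> (y + h *\<^sub>R d) - \<phi> y) / h"
  have "\<forall>\<^sub>F p in nhds x \<times>\<^sub>F at_right 0. (\<lambda>(y, h). ereal (?q y h)) p < ereal c"
    using assms unfolding clarke_dderiv_def by (rule Limsup_lessD)
  then obtain P Q where P: "eventually P (nhds x)" and Q: "eventually Q (at_right 0)"
    and PQ: "\<And>y h. P y \<Longrightarrow> Q h \<Longrightarrow> ?q y h < c"
    unfolding eventually_prod_filter by auto
  from P have "\<forall>\<^sub>F y in nhds x. eventually P (nhds y)"
    by (simp add: eventually_eventually)
  then show ?thesis
  proof (rule eventually_mono)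
    fix y assume "eventually P (nhds y)"
    then have "\<forall>\<^sub>F p in nhds y \<times>\<^sub>F at_right 0. P (fst p) \<and> Q (snd p)"
      using Q unfolding eventually_prod_filter by auto
    then show "clarke_dderiv \<phi> y d \<le> ereal c"
      by (intro clarke_dderiv_le_of_eventually) (auto elim!: eventually_mono dest: PQ less_imp_le)
  qed
qed

text \<open>For each direction the defining inequality survives the limit, because the generalized
  derivative is upper semicontinuous in the base point.\<close>

lemma clarke_subdiff_closed_graph:
  assumes "x \<longlonglongrightarrow> xbar" and "s \<longlonglongrightarrow> sbar" and "\<And>k. s k \<in> clarke_subdiff \<phi> (x k)"
  shows "sbar \<in> clarke_subdiff \<phi> xbar"
  unfolding clarke_subdiff_def
\<comment> \<open>Comparing with real upper bounds \<open>c\<close> of the derivative also covers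
  infinite values; the slack \<open>e\<close> below supplies the strict inequality that
  semicontinuity asks for.\<close>
proof (rule CollectI, rule allI, rule ereal_le_real)
  fix d c assume "clarke_dderiv \<phi> xbar d \<le> ereal c"
  have "sbar \<bullet> d \<le> c + e" if "e > 0" for e
  proof (rule tendsto_upperbound)
    show "(\<lambda>k. s k \<bullet> d) \<longlonglongrightarrow> sbar \<bullet> d"
      using assms(2) by (intro tendsto_intros)
    have "clarke_dderiv \<phi> xbar d < ereal (c + e)"
      using \<open>clarke_dderiv \<phi> xbar d \<le> ereal c\<close> that by (simp add: le_less_trans)
    from filterlim_iff[THEN iffD1, OF assms(1), rule_format, OF eventually_clarke_dderiv_le[OF this]]
    show "\<forall>\<^sub>F k in sequentially. s k \<bullet> d \<le> c + e"
    proof (rule eventually_mono)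
      fix k assume "clarke_dderiv \<phi> (x k) d \<le> ereal (c + e)"
      moreover have "ereal (s k \<bullet> d) \<le> clarke_dderiv \<phi> (x k) d"
        using assms(3)[of k] by (simp add: clarke_subdiff_def)
      ultimately show "s k \<bullet> d \<le> c + e"
        by (meson ereal_less_eq(3) order_trans)
    qed
  qed simp
  then show "ereal (sbar \<bullet> d) \<le> ereal c"
    by (simp add: field_le_epsilon)
qed

text \<open>Test \<open>s\<close> in its own direction: \<open>s \<bullet> s\<close> is at most the
  derivative along \<open>s\<close>, which is at most \<open>L * norm s\<close>. Openness of
  \<open>U\<close> keeps both ends of the difference quotient where the Lipschitz bound
  applies.\<close>

lemma clarke_subdiff_norm_le:
  assumes "L-lipschitz_on U \<phi>" and "open U" and "x \<in> U" and "s \<in> clarke_subdiff \<phi> x"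
  shows "norm s \<le> L"
proof -
  have "((\<lambda>p. fst p + snd p *\<^sub>R s) \<longlongrightarrow> x + 0 *\<^sub>R s) (nhds x \<times>\<^sub>F at_right (0::real))"
    by (intro tendsto_intros filterlim_fst filterlim_compose[OF _ filterlim_snd])
  then have 1: "\<forall>\<^sub>F p in nhds x \<times>\<^sub>F at_right 0. fst p + snd p *\<^sub>R s \<in> U"
    using assms(2,3) by (intro topological_tendstoD) auto
  have 2: "\<forall>\<^sub>F p in nhds x \<times>\<^sub>F at_right (0::real). fst p \<in> U"
    using assms(2,3) by (intro topological_tendstoD[OF filterlim_fst]) auto
  have 3: "\<forall>\<^sub>F p in nhds x \<times>\<^sub>F at_right (0::real). 0 < snd p"
    using filterlim_snd[THEN filterlim_iff[THEN iffD1], rule_format, OF eventually_at_right_less] .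
  have "\<forall>\<^sub>F (y, h) in nhds x \<times>\<^sub>F at_right 0. (\<phi> (y + h *\<^sub>R s) - \<phi> y) / h \<le> L * norm s"
    using 1 2 3
  proof eventually_elim
    case (elim p)
    obtain y h where p: "p = (y, h)" by fastforce
    have "\<phi> (y + h *\<^sub>R s) - \<phi> y \<le> L * (h * norm s)"
      using lipschitz_onD[OF assms(1), of "y + h *\<^sub>R s" y] elim
      by (simp add: p dist_norm)
    then show ?case
      using elim by (simp add: p divide_le_eq mult_ac)
  qed
  then have "clarke_dderiv \<phi> x s \<le> ereal (L * norm s)"
    by (rule clarke_dderiv_le_of_eventually)
  moreover have "ereal (s \<bullet> s) \<le> clarke_dderiv \<phi> x s"
    using assms(4) by (simp add: clarke_subdiff_def)
  ultimately have "norm s * norm s \<le> L * norm s"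
    by (metis ereal_less_eq(3) order_trans power2_norm_eq_inner power2_eq_square)
  then show ?thesis
    using lipschitz_on_nonneg[OF assms(1)] by (cases "s = 0") auto
qed

text \<open>One Lipschitz constant on a ball around \<open>xbar\<close> bounds all subgradients
  taken in it, and the tail of \<open>x\<close> stays in that ball.\<close>

lemma clarke_subdiff_sequence_bounded:
  assumes "locally_lipschitz \<phi>" and "x \<longlonglongrightarrow> xbar" and "\<And>k. s k \<in> clarke_subdiff \<phi> (x k)"
  shows "Bseq s"
proof -
  obtain r L where "r > 0" and L: "L-lipschitz_on (cball xbar r) \<phi>"
    using assms(1) unfolding locally_lipschitz_iff by blast
  have "L-lipschitz_on (ball xbar r) \<phi>"
    using L by (rule lipschitz_on_subset) auto
  moreover have "\<forall>\<^sub>F k in sequentially. x k \<in> ball xbar r"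
    using \<open>r > 0\<close> by (intro topological_tendstoD[OF assms(2)]) auto
  ultimately have "\<forall>\<^sub>F k in sequentially. norm (s k) \<le> L"
    by (auto elim!: eventually_mono intro: clarke_subdiff_norm_le[OF _ _ _ assms(3)])
  then show ?thesis
    by (rule BfunI)
qed

section \<open>Componentwise facts and complementarity\<close>

lemma locally_lipschitz_vec_nth:
  fixes g :: "'a::metric_space \<Rightarrow> 'b::metric_space ^ 'q"
  assumes "locally_lipschitz g"
  shows "locally_lipschitz (\<lambda>x. g x $ j)"
proof -
  have "L-lipschitz_on U (\<lambda>x. g x $ j)" if "L-lipschitz_on U g" for L U
    using that unfolding lipschitz_on_def by (meson dist_vec_nth_le order_trans)
  then show ?thesis
    using assms unfolding locally_lipschitz_iff by meson
qed

lemma bounded_vec_componentwise: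
  fixes S :: "('a::real_normed_vector ^ 'q) set"
  assumes "\<And>j. bounded ((\<lambda>v. v $ j) ` S)"
  shows "bounded S"
proof -
  have "\<forall>j. \<exists>B. \<forall>v\<in>S. norm (v $ j) \<le> B"
    using assms unfolding bounded_iff by simp
  then obtain B where B: "norm (v $ j) \<le> B j" if "v \<in> S" for j v
    by metis
  have "norm v \<le> (\<Sum>j\<in>UNIV. B j)" if "v \<in> S" for v
    using L2_set_le_sum[of UNIV "\<lambda>j. norm (v $ j)"] sum_mono[of UNIV "\<lambda>j. norm (v $ j)" B] B[OF that]
    unfolding norm_vec_def by force
  then show ?thesis
    unfolding bounded_iff by blast
qed

text \<open>The products \<open>u $ i * c $ i\<close> are all nonpositive and sum to zero, so each
  of them vanishes.\<close>

lemma complementary_multiplier_eq_0: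
  fixes u c :: "real ^ 'q"
  assumes "0 \<le> u" and "c \<le> 0" and "u \<bullet> c = 0" and "c $ j \<noteq> 0"
  shows "u $ j = 0"
proof -
  have "(\<Sum>j\<in>UNIV. - (u $ j * c $ j)) = 0"
    using assms(3) by (simp add: inner_vec_def sum_negf)
  moreover have "0 \<le> - (u $ i * c $ i)" for i
    using assms(1,2) by (simp add: less_eq_vec_def mult_nonneg_nonpos)
  ultimately have "- (u $ j * c $ j) = 0"
    using sum_nonneg_eq_0_iff[of UNIV "\<lambda>j. - (u $ j * c $ j)"] by simp
  then show ?thesis
    using assms(4) by simp
qed

section \<open>Normalised multipliers and their limit\<close>

theorem theorem3p6:
  fixes f :: "real ^ 'n \<Rightarrow> real"
    and g :: "real ^ 'n \<Rightarrow> real ^ 'q"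
    and xbar :: "real ^ 'n"
  assumes "locally_lipschitz f"
    and "locally_lipschitz g"
    and "g xbar \<le> 0"
    and "subMFC f g xbar"
  shows "KKT_point f g xbar"
proof -
  obtain I x u \<delta> \<epsilon> where I: "I \<subseteq> active_set g xbar"
    and MF: "I \<noteq> {} \<longrightarrow>
           (\<forall>v :: 'q \<Rightarrow> real. (\<forall>j\<in>I. 0 \<le> v j) \<and> (\<exists>j\<in>I. v j \<noteq> 0) \<longrightarrow>
              0 \<notin> (\<Sum>j\<in>I. (*\<^sub>R) (v j) ` clarke_subdiff (\<lambda>x. g x $ j) xbar))"
    and AKKT: "AKKT_sequence f g xbar x u \<delta> \<epsilon>"
    and act: "\<And>k. I = active_set_pert g (x k) (\<delta> k)"
    using assms(4) unfolding subMFC_def by blast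
  have \<epsilon>: "\<epsilon> k \<in> clarke_subdiff f (x k)
                + (\<Sum>j\<in>UNIV. (*\<^sub>R) (u k $ j) ` clarke_subdiff (\<lambda>y. g y $ j) (x k))"
    and u0: "0 \<le> u k" and g\<delta>: "g (x k) - \<delta> k \<le> 0" and comp: "u k \<bullet> (g (x k) - \<delta> k) = 0" for k
    using AKKT unfolding AKKT_sequence_def by auto
  have lim: "(\<lambda>k. (x k, \<delta> k, \<epsilon> k)) \<longlonglongrightarrow> (xbar, 0, 0)"
    using AKKT unfolding AKKT_sequence_def by simp
  have xlim: "x \<longlonglongrightarrow> xbar" and \<epsilon>lim: "\<epsilon> \<longlonglongrightarrow> 0"
    using tendsto_fst[OF lim] tendsto_snd[OF tendsto_snd[OF lim]] by simp_all
  have u_nonneg: "0 \<le> u k $ j" for k j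
    using u0[of k] by (simp add: less_eq_vec_def)
  \<comment> \<open>Off \<open>I\<close> the perturbed constraint is strictly slack at
    \<open>x k\<close>, so complementarity removes its multiplier.\<close>
  have u_off: "u k $ j = 0" if "j \<notin> I" for k j
    using that complementary_multiplier_eq_0[OF u0 g\<delta> comp, of k j] act[of k]
    by (simp add: active_set_pert_def)

  \<comment> \<open>Bundling the three conditions lets \<open>a k\<close> and the whole family
    \<open>b k\<close> be chosen together. A subgradient exists for every \<open>j\<close>, even
    when \<open>u k $ j = 0\<close>, since no summand of a nonempty Minkowski sum is empty.\<close>
  define P where "P k a b \<longleftrightarrow> a \<in> clarke_subdiff f (x k) \<and>
      (\<forall>j. b j \<in> clarke_subdiff (\<lambda>y. g y $ j) (x k)) \<and>
      \<epsilon> k = a + (\<Sum>j\<in>UNIV. u k $ j *\<^sub>R b j)" for k a b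
  have "\<exists>a b. P k a b" for k
    using \<epsilon>[of k] by (auto simp: P_def mem_sum_scaleR_image_iff elim!: set_plus_elim)
  then obtain a b where "P k (a k) (b k)" for k
    by metis
  then have a: "a k \<in> clarke_subdiff f (x k)"
    and b: "b k j \<in> clarke_subdiff (\<lambda>y. g y $ j) (x k)"
    and ab: "\<epsilon> k = a k + (\<Sum>j\<in>UNIV. u k $ j *\<^sub>R b k j)" for k j
    by (simp_all add: P_def)

  \<comment> \<open>The summand 1 is the coefficient of \<open>a k\<close>; after scaling,
    \<open>l k\<close> and the entries of \<open>w k\<close> are convex weights, however large
    \<open>u k\<close> is.\<close>
  define l where "l k = inverse (1 + (\<Sum>j\<in>UNIV. u k $ j))" for k
  define w where "w k = l k *\<^sub>R u k" for k
  have S: "0 \<le> (\<Sum>j\<in>UNIV. u k $ j)" for k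
    by (simp add: sum_nonneg u_nonneg)
  then have l: "0 \<le> l k" "l k \<le> 1" for k
    by (simp_all add: l_def inverse_le_1_iff)
  have "l k + (\<Sum>j\<in>UNIV. w k $ j) = l k * (1 + (\<Sum>j\<in>UNIV. u k $ j))" for k
    by (simp add: w_def sum_distrib_left distrib_left)
  moreover have "1 + (\<Sum>j\<in>UNIV. u k $ j) \<noteq> 0" for k
    using S[of k] by linarith
  ultimately have lw: "l k + (\<Sum>j\<in>UNIV. w k $ j) = 1" for k
    by (simp add: l_def)
  have w0: "0 \<le> w k $ j" for k j
    using l u_nonneg by (simp add: w_def)
  have w1: "w k $ j \<le> 1" for k j
    using member_le_sum[of j UNIV "\<lambda>j. w k $ j"] lw[of k] l(1)[of k] w0 by simp

  \<comment> \<open>Collected in one finite-dimensional space, all the sequences converge along a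
    common subsequence \<open>r\<close>.\<close>
  let ?z = "\<lambda>k. (l k, w k, a k, \<chi> j. b k j)"
  have "bounded (range l)"
    using l by (intro boundedI[of _ 1]) auto
  moreover have "bounded (range w)"
    using w0 w1 by (intro bounded_vec_componentwise boundedI[of _ 1]) auto
  moreover have "bounded (range a)"
    using clarke_subdiff_sequence_bounded[OF assms(1) xlim a] by (simp add: Bseq_eq_bounded)
  moreover have "bounded (range (\<lambda>k. \<chi> j. b k j))"
    using clarke_subdiff_sequence_bounded[OF locally_lipschitz_vec_nth[OF assms(2)] xlim b]
    by (simp add: Bseq_eq_bounded image_image bounded_vec_componentwise)
  ultimately have "bounded (range l \<times> range w \<times> range a \<times> range (\<lambda>k. \<chi> j. b k j))"
    by (intro bounded_Times)
  then have "bounded (range ?z)"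
    by (rule bounded_subset) auto
  then obtain z r where r: "strict_mono r" and "(?z \<circ> r) \<longlonglongrightarrow> z"
    using bounded_imp_convergent_subsequence by blast
  moreover obtain L W A B where "z = (L, W, A, B)"
    by (metis prod.exhaust)
  ultimately have zlim: "(\<lambda>k. ?z (r k)) \<longlonglongrightarrow> (L, W, A, B)"
    by (simp add: o_def)
  have Llim: "(\<lambda>k. l (r k)) \<longlonglongrightarrow> L"
    using tendsto_fst[OF zlim] by simp
  have Wlim: "(\<lambda>k. w (r k) $ j) \<longlonglongrightarrow> W $ j" for j
    using tendsto_vec_nth[OF tendsto_fst[OF tendsto_snd[OF zlim]]] by simp
  have Alim: "(\<lambda>k. a (r k)) \<longlonglongrightarrow> A"
    using tendsto_fst[OF tendsto_snd[OF tendsto_snd[OF zlim]]] by simp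
  have Blim: "(\<lambda>k. b (r k) j) \<longlonglongrightarrow> B $ j" for j
    using tendsto_vec_nth[OF tendsto_snd[OF tendsto_snd[OF tendsto_snd[OF zlim]]], of j] by simp
  have xr: "(\<lambda>k. x (r k)) \<longlonglongrightarrow> xbar" and \<epsilon>r: "(\<lambda>k. \<epsilon> (r k)) \<longlonglongrightarrow> 0"
    using LIMSEQ_subseq_LIMSEQ[OF xlim r] LIMSEQ_subseq_LIMSEQ[OF \<epsilon>lim r] by (simp_all add: o_def)

  have A: "A \<in> clarke_subdiff f xbar"
    by (rule clarke_subdiff_closed_graph[OF xr Alim a])
  have B: "B $ j \<in> clarke_subdiff (\<lambda>y. g y $ j) xbar" for j
    by (rule clarke_subdiff_closed_graph[OF xr Blim b])
  have L0: "0 \<le> L"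
    by (rule LIMSEQ_le_const[OF Llim]) (simp add: l(1))
  have W0: "0 \<le> W $ j" for j
    by (rule LIMSEQ_le_const[OF Wlim]) (simp add: w0)
  \<comment> \<open>Since \<open>I\<close> is the same set for all \<open>k\<close>, the vanishing
    entries are the same along the whole sequence.\<close>
  have W_off: "W $ j = 0" if "j \<notin> I" for j
    using Wlim[of j] u_off[OF that] by (simp add: w_def LIMSEQ_const_iff)
  have "(\<lambda>k. l (r k) + (\<Sum>j\<in>UNIV. w (r k) $ j)) \<longlonglongrightarrow> L + (\<Sum>j\<in>UNIV. W $ j)"
    by (intro tendsto_intros Llim Wlim)
  then have LW: "L + (\<Sum>j\<in>UNIV. W $ j) = 1"
    by (simp add: lw LIMSEQ_const_iff)
  have "(\<lambda>k. l (r k) *\<^sub>R a (r k) + (\<Sum>j\<in>UNIV. w (r k) $ j *\<^sub>R b (r k) j)) \<longlonglongrightarrow>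
      L *\<^sub>R A + (\<Sum>j\<in>UNIV. W $ j *\<^sub>R B $ j)"
    by (intro tendsto_intros Llim Wlim Alim Blim)
  moreover have "l k *\<^sub>R a k + (\<Sum>j\<in>UNIV. w k $ j *\<^sub>R b k j) = l k *\<^sub>R \<epsilon> k" for k
    by (simp add: ab w_def scaleR_right_distrib scaleR_sum_right)
  \<comment> \<open>Scaling does not spoil the vanishing of the residual, because the factors
    \<open>l (r k)\<close> converge.\<close>
  moreover have "(\<lambda>k. l (r k) *\<^sub>R \<epsilon> (r k)) \<longlonglongrightarrow> L *\<^sub>R 0"
    by (intro tendsto_intros Llim \<epsilon>r)
  ultimately have zero: "L *\<^sub>R A + (\<Sum>j\<in>UNIV. W $ j *\<^sub>R B $ j) = 0"
    using LIMSEQ_unique by fastforce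

  \<comment> \<open>If \<open>L = 0\<close>, the weights \<open>W\<close> sum to 1 and are supported
    on \<open>I\<close>. This yields an index in \<open>I\<close>, so that \<open>I\<close> is
    nonempty, and a nontrivial nonnegative combination of subgradients equal to zero, against
    \<open>MF\<close>.\<close>
  have "L \<noteq> 0"
  proof
    assume "L = 0"
    then have "(\<Sum>j\<in>UNIV. W $ j) \<noteq> 0" and sum0: "(\<Sum>j\<in>UNIV. W $ j *\<^sub>R B $ j) = 0"
      using LW zero by simp_all
    then obtain j where "W $ j \<noteq> 0"
      by (meson sum.neutral)
    then have "j \<in> I"
      using W_off by blast
    have "(\<Sum>j\<in>I. W $ j *\<^sub>R B $ j) = (\<Sum>j\<in>UNIV. W $ j *\<^sub>R B $ j)"
      by (rule sum.mono_neutral_left) (auto simp: W_off)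
    then have "0 \<in> (\<Sum>j\<in>I. (*\<^sub>R) (W $ j) ` clarke_subdiff (\<lambda>x. g x $ j) xbar)"
      using B sum0 by (subst mem_sum_scaleR_image_iff) (auto intro!: exI[of _ "\<lambda>j. B $ j"])
    then show False
      using MF \<open>j \<in> I\<close> \<open>W $ j \<noteq> 0\<close> W0 by blast
  qed
  define U where "U = inverse L *\<^sub>R W"
  have "A + (\<Sum>j\<in>UNIV. U $ j *\<^sub>R B $ j) = inverse L *\<^sub>R (L *\<^sub>R A + (\<Sum>j\<in>UNIV. W $ j *\<^sub>R B $ j))"
    using \<open>L \<noteq> 0\<close> by (simp add: U_def scaleR_right_distrib scaleR_sum_right)
  then have U: "A + (\<Sum>j\<in>UNIV. U $ j *\<^sub>R B $ j) = 0"
    by (simp add: zero)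
  have "(\<Sum>j\<in>UNIV. U $ j *\<^sub>R B $ j) \<in>
      (\<Sum>j\<in>UNIV. (*\<^sub>R) (U $ j) ` clarke_subdiff (\<lambda>x. g x $ j) xbar)"
    using B by (subst mem_sum_scaleR_image_iff) auto
  from set_plus_intro[OF A this] have "0 \<in> clarke_subdiff f xbar
      + (\<Sum>j\<in>UNIV. (*\<^sub>R) (U $ j) ` clarke_subdiff (\<lambda>x. g x $ j) xbar)"
    unfolding U .
  moreover have "0 \<le> U"
    using L0 W0 by (simp add: U_def less_eq_vec_def)
  \<comment> \<open>Off \<open>I\<close> the multiplier vanishes; on \<open>I\<close> the constraint
    is active at \<open>xbar\<close>.\<close>
  moreover have "U $ j * g xbar $ j = 0" for j
    using W_off[of j] I by (auto simp: U_def active_set_def)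
  then have "U \<bullet> g xbar = 0"
    unfolding inner_vec_def inner_real_def by (intro sum.neutral) blast
  ultimately show ?thesis
    using assms(3) unfolding KKT_point_def by blast
qed

end
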